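(* Let $G$ be any signed complex representing an element of the strong ring. Then its connection Laplacian $L(G)$ is unimodular, i.e. it is an integer matrix with $\det L(G)\in\{1,-1\}$, and the total energy is the Euler characteristic: with $g=L(G)^{-1}$, one has $\sum_{x,y} g(x,y)=\chi(G)$, the sum being over all pairs of cells of $G$.
   Context: A finite abstract simplicial complex is a finite set of finite non-empty sets which is closed under taking non-empty subsets; $\dim(x)=|x|-1$ for a simplex $x$. A product complex is a finite Cartesian product $G_1\times\cdots\times G_n$ ($n\ge 1$) of finite abstract simplicial complexes; its cells are the sets $x=x_1\times\cdots\times x_n$ with $x_i\in G_i$, and $\dim(x)=\sum_i\dim(x_i)$, $\omega(x)=(-1)^{\dim(x)}$. Two product complexes are isomorphic if there is a bijection between their cells preserving inclusion in both directions. A signed complex is a finite formal disjoint union of product complexes, each summand carrying a sign in $\{1,-1\}$; cells in different summands are regarded as disjoint. Addition is disjoint union, $-G$ reverses all signs, and products are taken term by term with signs multiplied. The strong ring is the ring of signed complexes modulo isomorphism of summands, splitting of summands into connected components, and cancellation of $G\oplus(-G)$; its zero is the empty complex and its one is the one-point complex $K_1$. For a product complex $G$ the connection Laplacian $L(G)$ is the matrix indexed by the cells of $G$ with $L(x,y)=1$ if $x\cap y\ne\emptyset$ and $L(x,y)=0$ otherwise, and $\chi(G)=\sum_{x}\omega(x)$, the sum being over all cells. For a signed complex with summands $G_i$ and signs $\varepsilon_i$, $L(G)$ is the direct sum of the matrices $\varepsilon_iL(G_i)$ and $\chi(G)=\sum_i\varepsilon_i\chi(G_i)$. *)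

theory Defs
  imports "HOL-Algebra.Ring" "HOL-Library.Multiset" "Jordan_Normal_Form.Determinant"
begin

definition simplicial_complex :: "'a set set \<Rightarrow> bool" where
  "simplicial_complex K \<longleftrightarrow>
     finite K \<and> (\<forall>s\<in>K. finite s \<and> s \<noteq> {}) \<and> (\<forall>s\<in>K. \<forall>t. t \<noteq> {} \<and> t \<subseteq> s \<longrightarrow> t \<in> K)"


section \<open>Product complexes\<close>

text \<open>The product of \<open>K\<^sub>1, \<dots>, K\<^sub>n\<close> is the list of its factors. Points of the
  Cartesian product are lists of length \<open>n\<close>, so that the cell \<open>x\<^sub>1 \<times> \<dots> \<times> x\<^sub>n\<close> is
  \<^term>\<open>listset [x\<^sub>1, x\<^sub>2, x\<^sub>3]\<close> for \<open>n = 3\<close>.\<close>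

type_synonym 'a product = "'a set set list"

definition product_complex :: "'a product \<Rightarrow> bool" where
  "product_complex P \<longleftrightarrow> P \<noteq> [] \<and> (\<forall>K\<in>set P. simplicial_complex K)"

definition pcells :: "'a product \<Rightarrow> 'a list set set" where
  "pcells P = listset ` listset P"

text \<open>A cell is a plain set of points; its \<open>i\<close>-th factor is recovered by projecting to the
  \<open>i\<close>-th coordinate, see \<open>cell_dim_listset\<close> below.\<close>

definition cell_dim :: "'a product \<Rightarrow> 'a list set \<Rightarrow> nat" where
  "cell_dim P x = (\<Sum>i<length P. card ((\<lambda>p. p ! i) ` x) - 1)"

definition omega :: "'a product \<Rightarrow> 'a list set \<Rightarrow> int" where
  "omega P x = (- 1) ^ cell_dim P x"

definition product_isomorphic :: "'a product \<Rightarrow> 'a product \<Rightarrow> bool" where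
  "product_isomorphic P Q \<longleftrightarrow>
     (\<exists>f. bij_betw f (pcells P) (pcells Q) \<and>
          (\<forall>x\<in>pcells P. \<forall>y\<in>pcells P. f x \<subseteq> f y \<longleftrightarrow> x \<subseteq> y))"

definition components :: "'a product \<Rightarrow> 'a list set set set" where
  "components P =
     pcells P // {(x, y). x \<in> pcells P \<and> y \<in> pcells P \<and> (x \<subseteq> y \<or> y \<subseteq> x)}\<^sup>+"


section \<open>Signed complexes and the strong ring\<close>

type_synonym 'a signed = "(int \<times> 'a product) list"

definition signed_complex :: "'a signed \<Rightarrow> bool" where
  "signed_complex G \<longleftrightarrow> (\<forall>(e, P)\<in>set G. e \<in> {1, - 1} \<and> product_complex P)"

definition signed_uminus :: "'a signed \<Rightarrow> 'a signed" where
  "signed_uminus G = map (\<lambda>(e, P). (- e, P)) G"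

definition signed_times :: "'a signed \<Rightarrow> 'a signed \<Rightarrow> 'a signed" where
  "signed_times G H = concat (map (\<lambda>(e, P). map (\<lambda>(d, Q). (e * d, P @ Q)) H) G)"

text \<open>The rule \<open>perm\<close> makes the list of summands a formal sum without order.\<close>

inductive signed_step :: "'a signed \<Rightarrow> 'a signed \<Rightarrow> bool" where
  perm: "mset G = mset H \<Longrightarrow> signed_step G H"
| iso: "product_isomorphic P Q \<Longrightarrow> signed_step ((e, P) # G) ((e, Q) # G)"
| split: "distinct (map pcells Qs) \<Longrightarrow> set (map pcells Qs) = components P \<Longrightarrow>
    signed_step ((e, P) # G) (map (Pair e) Qs @ G)"
| cancel: "signed_step (H @ signed_uminus H @ G) G"

definition strong_equiv :: "('a signed \<times> 'a signed) set" where
  "strong_equiv =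
     {(G, H). signed_complex G \<and> signed_complex H \<and> (signed_step G H \<or> signed_step H G)}\<^sup>+"

text \<open>The choice of the vertex \<^term>\<open>undefined\<close> in the unit is immaterial, as all one-point
  complexes are isomorphic.\<close>

definition strong_ring :: "'a signed set ring" where
  "strong_ring =
     \<lparr>carrier = {G. signed_complex G} // strong_equiv,
      mult = (\<lambda>X Y. \<Union>G\<in>X. \<Union>H\<in>Y. strong_equiv `` {signed_times G H}),
      one = strong_equiv `` {[(1, [{{undefined}}])]},
      zero = strong_equiv `` {[]},
      add = (\<lambda>X Y. \<Union>G\<in>X. \<Union>H\<in>Y. strong_equiv `` {G @ H})\<rparr>"


section \<open>Connection Laplacian and Euler characteristic\<close>

definition cells :: "'a signed \<Rightarrow> (nat \<times> 'a list set) set" where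
  "cells G = (SIGMA i:{..<length G}. pcells (snd (G ! i)))"

definition product_laplacian :: "'a list set \<Rightarrow> 'a list set \<Rightarrow> int" where
  "product_laplacian x y = (if x \<inter> y \<noteq> {} then 1 else 0)"

definition connection_laplacian ::
    "'a signed \<Rightarrow> nat \<times> 'a list set \<Rightarrow> nat \<times> 'a list set \<Rightarrow> int" where
  "connection_laplacian G = (\<lambda>(i, x) (j, y).
     if i = j then fst (G ! i) * product_laplacian x y else 0)"

text \<open>The matrix of an array indexed by a finite set, which \<open>cs\<close> enumerates.\<close>

definition mat_of :: "'c list \<Rightarrow> ('c \<Rightarrow> 'c \<Rightarrow> 'r) \<Rightarrow> 'r mat" where
  "mat_of cs A = mat (length cs) (length cs) (\<lambda>(i, j). A (cs ! i) (cs ! j))"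

definition product_euler_char :: "'a product \<Rightarrow> int" where
  "product_euler_char P = (\<Sum>x\<in>pcells P. omega P x)"

definition euler_char :: "'a signed \<Rightarrow> int" where
  "euler_char G = (\<Sum>(e, P)\<leftarrow>G. e * product_euler_char P)"


section \<open>Consistency of the definitions\<close>

lemma listset_conv: "listset As = {p. length p = length As \<and> (\<forall>i<length As. p ! i \<in> As ! i)}"
proof (induction As)
  case IH: (Cons A As)
  have "p \<in> listset (A # As) \<longleftrightarrow>
      length p = length (A # As) \<and> (\<forall>i<length (A # As). p ! i \<in> (A # As) ! i)" for p
  proof (cases p)
    case (Cons a q)
    then have "p \<in> listset (A # As) \<longleftrightarrow> a \<in> A \<and> q \<in> listset As"
      by (simp add: set_Cons_def)
    also have "\<dots> \<longleftrightarrow> a \<in> A \<and> length q = length As \<and> (\<forall>i<length As. q ! i \<in> As ! i)"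
      using IH by simp
    also have "\<dots> \<longleftrightarrow> length p = length (A # As) \<and> (\<forall>i<length (A # As). p ! i \<in> (A # As) ! i)"
      unfolding Cons list.size add_Suc_right add_0_right All_less_Suc2 by simp blast
    finally show ?thesis .
  qed (simp add: set_Cons_def)
  then show ?case by blast
qed auto

lemma finite_listset: "\<forall>A\<in>set As. finite A \<Longrightarrow> finite (listset As)"
proof (induction As)
  case (Cons A As)
  have "listset (A # As) = (\<lambda>(a, p). a # p) ` (A \<times> listset As)"
    by (auto simp: set_Cons_def)
  with Cons show ?case by simp
qed simp

lemma proj_listset:
  assumes "\<forall>A\<in>set As. A \<noteq> {}" "i < length As"
  shows "(\<lambda>p. p ! i) ` listset As = As ! i"
proof
  show "(\<lambda>p. p ! i) ` listset As \<subseteq> As ! i"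
    using assms(2) by (auto simp: listset_conv)
  show "As ! i \<subseteq> (\<lambda>p. p ! i) ` listset As"
  proof
    fix a assume a: "a \<in> As ! i"
    define p where "p = (map (\<lambda>A. SOME b. b \<in> A) As)[i := a]"
    have "p ! j \<in> As ! j" if "j < length As" for j
    proof (cases "j = i")
      case False
      have "As ! j \<noteq> {}" using assms(1) that by simp
      then show ?thesis using False that by (simp add: p_def some_in_eq)
    qed (use a that in \<open>simp add: p_def\<close>)
    then have "p \<in> listset As" by (simp add: listset_conv p_def)
    moreover have "p ! i = a" using assms(2) by (simp add: p_def)
    ultimately show "a \<in> (\<lambda>p. p ! i) ` listset As" by blast
  qed
qed

lemma simplices_nonempty:
  assumes "product_complex P" "xs \<in> listset P"
  shows "\<forall>x\<in>set xs. x \<noteq> {}"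
proof
  fix x assume "x \<in> set xs"
  then obtain i where "i < length xs" "x = xs ! i" by (auto simp: in_set_conv_nth)
  then have "i < length P" "x \<in> P ! i" using assms(2) by (simp_all add: listset_conv)
  then have "x \<in> P ! i" "simplicial_complex (P ! i)"
    using assms(1) by (simp_all add: product_complex_def)
  then show "x \<noteq> {}" by (simp add: simplicial_complex_def)
qed

lemma cell_dim_listset:
  assumes "product_complex P" "xs \<in> listset P"
  shows "cell_dim P (listset xs) = (\<Sum>i<length P. card (xs ! i) - 1)"
proof -
  have "length xs = length P" using assms(2) by (simp add: listset_conv)
  then show ?thesis
    using proj_listset[OF simplices_nonempty[OF assms]] by (simp add: cell_dim_def)
qed

lemma inj_on_listset:
  assumes "product_complex P"
  shows "inj_on listset (listset P)"
proof (rule inj_onI)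
  fix xs ys assume *: "xs \<in> listset P" "ys \<in> listset P" "listset xs = listset ys"
  then have len: "length xs = length P" "length ys = length P" by (auto simp: listset_conv)
  show "xs = ys"
  proof (rule nth_equalityI)
    fix i assume "i < length xs"
    then show "xs ! i = ys ! i"
      using proj_listset[OF simplices_nonempty[OF assms *(1)], of i]
        proj_listset[OF simplices_nonempty[OF assms *(2)], of i] *(3) len by simp
  qed (simp add: len)
qed

lemma finite_cells:
  assumes "signed_complex G"
  shows "finite (cells G)"
  unfolding cells_def
proof (rule finite_SigmaI)
  fix i assume "i \<in> {..<length G}"
  then have "G ! i \<in> set G" by simp
  then have P: "product_complex (snd (G ! i))"
    using assms by (auto simp: signed_complex_def case_prod_beta)
  have "finite K" if "K \<in> set (snd (G ! i))" for K
    using P that by (simp add: product_complex_def simplicial_complex_def)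
  then show "finite (pcells (snd (G ! i)))"
    unfolding pcells_def by (simp add: finite_listset)
qed simp

lemma equiv_strong_equiv: "equiv {G :: 'a signed. signed_complex G} strong_equiv"
proof -
  let ?R = "{(G, H :: 'a signed). signed_complex G \<and> signed_complex H \<and> (signed_step G H \<or> signed_step H G)}"
  have "?R\<^sup>+ \<subseteq> {G. signed_complex G} \<times> {G. signed_complex G}"
    by (rule trancl_subset_Sigma) blast
  moreover have "refl_on {G. signed_complex G} (?R\<^sup>+)"
  proof (rule refl_onI)
    fix G :: "'a signed" assume "G \<in> {G. signed_complex G}"
    then have "(G, G) \<in> ?R" using signed_step.perm[of G G] by simp
    then show "(G, G) \<in> ?R\<^sup>+" by (rule r_into_trancl)
  qed
  moreover have "sym (?R\<^sup>+)"
    by (rule sym_trancl) (simp add: sym_def, blast)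
  ultimately show ?thesis
    unfolding strong_equiv_def equiv_def by simp
qed

end

theory Submission
  imports Defs
begin

text \<open>
  Let \<open>S\<close> be the matrix on the cells with \<open>S(x, z) = \<omega>(z)\<close> if \<open>z \<subseteq> x\<close> and \<open>0\<close> otherwise,
  and let \<open>D\<close> be the diagonal matrix of the values \<open>\<epsilon>\<omega>(z)\<close>, where \<open>\<epsilon>\<close> is the sign of the
  summand that contains \<open>z\<close>. Three facts give the result.

  \<^item> \<open>S\<^sup>2 = 1\<close>: the \<open>(x, y)\<close> entry is an alternating sum over the interval of cells between \<open>y\<close>
    and \<open>x\<close>, so this is Moebius inversion in the face poset
    (\<open>signed_face_sign_involution\<close>).
  \<^item> \<open>L = S D S\<^sup>T\<close>: the \<open>(x, y)\<close> entry of the right side is \<open>\<epsilon>\<close> times the Euler characteristic of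
    the set of cells inside \<open>x \<inter> y\<close>. That set is empty, or it is a product of full simplices, of
    Euler characteristic \<open>1\<close> (\<open>connection_laplacian_factorization\<close>).
  \<^item> \<open>S\<close> has row sums \<open>1\<close>: again, a closed cell has Euler characteristic \<open>1\<close>
    (\<open>signed_face_sign_row_sum\<close>).

  Since \<open>S\<^sup>2 = D\<^sup>2 = 1\<close>, the integer matrix \<open>g = S\<^sup>T D S\<close> is a two-sided inverse of \<open>L\<close>. Hence
  \<open>det L\<close> divides \<open>1\<close>, and with \<open>u\<close> the vector of ones the sum of all entries of \<open>g\<close> is
  \<open>u\<^sup>T S\<^sup>T D S u = u\<^sup>T D u\<close>, which is the sum of the \<open>\<epsilon>\<omega>(z)\<close>, the Euler characteristic.

  The first two facts factor over Cartesian products, so that they need proof only for a single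
  simplicial complex, where they are instances of \<open>\<Sum>X\<subseteq>A. (-1)^|X| = 0\<close> for \<open>A \<noteq> \<emptyset>\<close>.
\<close>

section \<open>Matrices of arrays over an enumerated set\<close>

lemma sum_nth_distinct:
  assumes "distinct cs"
  shows "(\<Sum>i<length cs. f (cs ! i)) = (\<Sum>c\<in>set cs. f c)"
  using sum.reindex_bij_betw[OF bij_betw_nth[OF assms refl refl]] .

lemma mat_of_carrier [simp]: "mat_of cs A \<in> carrier_mat (length cs) (length cs)"
  by (simp add: mat_of_def)

lemma mat_of_cong:
  assumes "\<And>x y. x \<in> set cs \<Longrightarrow> y \<in> set cs \<Longrightarrow> A x y = B x y"
  shows "mat_of cs A = mat_of cs B"
  using assms by (auto simp: mat_of_def)

lemma mat_of_mult:
  assumes "distinct cs"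
  shows "mat_of cs A * mat_of cs B = mat_of cs (\<lambda>x y. \<Sum>z\<in>set cs. A x z * B z y)"
  using sum_nth_distinct[OF assms]
  by (intro eq_matI) (auto simp: mat_of_def scalar_prod_def atLeast0LessThan)

lemma mat_of_one:
  assumes "distinct cs"
  shows "mat_of cs (\<lambda>x y. of_bool (x = y)) = 1\<^sub>m (length cs)"
  using assms by (intro eq_matI) (auto simp: mat_of_def nth_eq_iff_index_eq)

lemma sum_entries_mat_of:
  assumes "distinct cs"
  shows "(\<Sum>i<length cs. \<Sum>j<length cs. mat_of cs A $$ (i, j)) = (\<Sum>x\<in>set cs. \<Sum>y\<in>set cs. A x y)"
proof -
  have "(\<Sum>i<length cs. \<Sum>j<length cs. mat_of cs A $$ (i, j)) =
      (\<Sum>i<length cs. \<Sum>j<length cs. A (cs ! i) (cs ! j))"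
    by (simp add: mat_of_def)
  also have "\<dots> = (\<Sum>x\<in>set cs. \<Sum>y\<in>set cs. A x y)"
    by (simp only: sum_nth_distinct[OF assms, of "A _"]
        sum_nth_distinct[OF assms, of "\<lambda>x. \<Sum>y\<in>set cs. A x y"])
  finally show ?thesis .
qed

text \<open>With \<open>D\<close> the diagonal matrix of \<open>d\<close>, the hypotheses read \<open>S\<^sup>2 = D\<^sup>2 = 1\<close> and \<open>L = S D S\<^sup>T\<close>.
  The transpose of an involution is an involution, so the product of \<open>S D S\<^sup>T\<close> and \<open>S\<^sup>T D S\<close>
  collapses from the inside, in either order.\<close>

lemma involution_factorization_inverse:
  fixes S L :: "'c \<Rightarrow> 'c \<Rightarrow> 'r :: comm_ring_1" and d :: "'c \<Rightarrow> 'r"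
  assumes cs: "distinct cs"
    and invol: "\<And>x y. x \<in> set cs \<Longrightarrow> y \<in> set cs \<Longrightarrow>
      (\<Sum>z\<in>set cs. S x z * S z y) = of_bool (x = y)"
    and d: "\<And>x. x \<in> set cs \<Longrightarrow> d x * d x = 1"
    and L: "\<And>x y. x \<in> set cs \<Longrightarrow> y \<in> set cs \<Longrightarrow>
      L x y = (\<Sum>z\<in>set cs. S x z * d z * S y z)"
  defines "g \<equiv> \<lambda>x y. \<Sum>z\<in>set cs. S z x * d z * S z y"
  shows "mat_of cs L * mat_of cs g = 1\<^sub>m (length cs)"
    and "mat_of cs g * mat_of cs L = 1\<^sub>m (length cs)"
proof -
  let ?n = "length cs"
  define s where "s = mat_of cs S"
  define t where "t = mat_of cs (\<lambda>x y. S y x)"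
  define D where "D = mat_of cs (\<lambda>x y. of_bool (x = y) * d x)"
  have carrier [simp]: "s \<in> carrier_mat ?n ?n" "t \<in> carrier_mat ?n ?n" "D \<in> carrier_mat ?n ?n"
    by (simp_all add: s_def t_def D_def)
  have ss: "s * s = 1\<^sub>m ?n"
    unfolding s_def mat_of_mult[OF cs] mat_of_one[OF cs, symmetric]
    by (rule mat_of_cong) (rule invol)
  have tt: "t * t = 1\<^sub>m ?n"
    unfolding t_def mat_of_mult[OF cs] mat_of_one[OF cs, symmetric]
  proof (rule mat_of_cong)
    fix x y assume "x \<in> set cs" "y \<in> set cs"
    then show "(\<Sum>z\<in>set cs. S z x * S y z) = of_bool (x = y)"
      using invol[of y x] by (simp add: mult.commute eq_commute[of x y])
  qed
  have diag: "mat_of cs A * D = mat_of cs (\<lambda>x y. A x y * d y)" for A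
    unfolding D_def mat_of_mult[OF cs]
  proof (rule mat_of_cong)
    fix x y assume "y \<in> set cs"
    have "(\<Sum>z\<in>set cs. A x z * (of_bool (z = y) * d z)) = (\<Sum>z\<in>set cs. if z = y then A x y * d y else 0)"
      by (rule sum.cong) auto
    also have "\<dots> = A x y * d y" using \<open>y \<in> set cs\<close> by simp
    finally show "(\<Sum>z\<in>set cs. A x z * (of_bool (z = y) * d z)) = A x y * d y" .
  qed
  have "D * D = mat_of cs (\<lambda>x y. of_bool (x = y) * d x * d y)"
    using diag unfolding D_def .
  also have "\<dots> = mat_of cs (\<lambda>x y. of_bool (x = y))"
    by (rule mat_of_cong) (auto simp: d)
  finally have DD: "D * D = 1\<^sub>m ?n" using mat_of_one[OF cs] by simp
  have sD: "s * D = mat_of cs (\<lambda>x y. S x y * d y)" and tD: "t * D = mat_of cs (\<lambda>x y. S y x * d y)"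
    unfolding s_def t_def by (rule diag)+
  have Lm: "mat_of cs L = s * D * t"
    unfolding sD unfolding t_def mat_of_mult[OF cs] by (rule mat_of_cong) (rule L)
  have gm: "mat_of cs g = t * D * s"
    unfolding tD unfolding s_def mat_of_mult[OF cs] g_def ..
  have conj: "(p * D * q) * (q * D * p) = 1\<^sub>m ?n"
    if pq [simp]: "p \<in> carrier_mat ?n ?n" "q \<in> carrier_mat ?n ?n"
      and "p * p = 1\<^sub>m ?n" "q * q = 1\<^sub>m ?n" for p q
  proof -
    note assoc = assoc_mult_mat[of _ ?n ?n _ ?n _ ?n] mult_carrier_mat[of _ ?n ?n _ ?n]
      left_mult_one_mat[of _ ?n ?n]
    have "(p * D * q) * (q * D * p) = p * (D * ((q * q) * (D * p)))"
      by (simp add: assoc)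
    also have "\<dots> = p * ((D * D) * p)"
      using that(4) by (simp add: assoc)
    also have "\<dots> = 1\<^sub>m ?n" using that(3) by (simp add: DD assoc)
    finally show ?thesis .
  qed
  show "mat_of cs L * mat_of cs g = 1\<^sub>m ?n" "mat_of cs g * mat_of cs L = 1\<^sub>m ?n"
    unfolding Lm gm using conj[of s t] conj[of t s] ss tt by simp_all
qed

text \<open>The left side is the quadratic form of \<open>S\<^sup>T D S\<close> at the vector of ones, which \<open>S\<close> fixes.\<close>

lemma involution_factorization_total:
  fixes S :: "'c \<Rightarrow> 'c \<Rightarrow> 'r :: comm_ring_1"
  assumes "\<And>z. z \<in> C \<Longrightarrow> (\<Sum>x\<in>C. S z x) = 1"
  shows "(\<Sum>x\<in>C. \<Sum>y\<in>C. \<Sum>z\<in>C. S z x * d z * S z y) = (\<Sum>z\<in>C. d z)"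
proof -
  have "(\<Sum>x\<in>C. \<Sum>y\<in>C. \<Sum>z\<in>C. S z x * d z * S z y) = (\<Sum>x\<in>C. \<Sum>z\<in>C. \<Sum>y\<in>C. S z x * d z * S z y)"
    by (intro sum.cong refl sum.swap)
  also have "\<dots> = (\<Sum>z\<in>C. \<Sum>x\<in>C. \<Sum>y\<in>C. S z x * d z * S z y)"
    by (rule sum.swap)
  also have "\<dots> = (\<Sum>z\<in>C. d z * ((\<Sum>x\<in>C. S z x) * (\<Sum>y\<in>C. S z y)))"
    by (simp add: sum_product sum_distrib_left mult_ac)
  also have "\<dots> = (\<Sum>z\<in>C. d z)" using assms by simp
  finally show ?thesis .
qed

section \<open>Alternating sums over a simplicial complex\<close>

text \<open>Expansion of the product of \<open>1 - 1\<close> over \<open>A\<close>.\<close>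

lemma sum_Pow_alternating:
  assumes "finite A"
  shows "(\<Sum>X\<in>Pow A. (- 1) ^ card X) = (of_bool (A = {}) :: int)"
  using prod_diff_conv_sum[OF assms, of "\<lambda>_. 1 :: int" "\<lambda>_. 1"] assms
  by (cases "A = {}") (simp_all add: power_0_left)

text \<open>The Euler characteristic of a full simplex. The exponent is the dimension \<open>|z| - 1\<close>, which
  flips the sign of each term of the sum over all subsets and leaves the term of the
  empty set as the result.\<close>

lemma sum_nonempty_subsets:
  assumes "finite A"
  shows "(\<Sum>z | z \<noteq> {} \<and> z \<subseteq> A. (- 1) ^ (card z - 1)) = (of_bool (A \<noteq> {}) :: int)"
proof -
  have "(\<Sum>z | z \<noteq> {} \<and> z \<subseteq> A. (- 1) ^ (card z - 1)) = (\<Sum>z\<in>Pow A - {{}}. - ((- 1) ^ card z) :: int)"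
  proof (rule sum.cong)
    fix z assume z: "z \<in> Pow A - {{}}"
    then have "finite z" using assms finite_subset by blast
    then have "card z \<noteq> 0" using z by simp
    then show "(- 1) ^ (card z - 1) = - ((- 1) ^ card z :: int)" by (cases "card z") auto
  qed auto
  also have "\<dots> = 1 - (\<Sum>z\<in>Pow A. (- 1) ^ card z)"
    using assms by (subst sum.remove[of "Pow A" "{}"]) (auto simp: sum_negf)
  also have "\<dots> = of_bool (A \<noteq> {})" using sum_Pow_alternating[OF assms] by simp
  finally show ?thesis .
qed

text \<open>The substitution \<open>z = y \<union> B\<close> turns the interval between \<open>y\<close> and \<open>x\<close> into the power set of
  \<open>x - y\<close>.\<close>

lemma sum_subset_interval:
  assumes "finite x" "y \<subseteq> x"
  shows "(\<Sum>z | y \<subseteq> z \<and> z \<subseteq> x. (- 1) ^ card z * (- 1) ^ card y) = (of_bool (x = y) :: int)"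
proof -
  have fin: "finite y" using assms finite_subset by blast
  have "(\<Sum>z | y \<subseteq> z \<and> z \<subseteq> x. (- 1) ^ card z * (- 1) ^ card y) =
      (\<Sum>B\<in>Pow (x - y). (- 1) ^ card B :: int)"
  proof (rule sum.reindex_bij_witness[where i = "\<lambda>B. y \<union> B" and j = "\<lambda>z. z - y"])
    fix z assume z: "z \<in> {z. y \<subseteq> z \<and> z \<subseteq> x}"
    then have "finite z" using assms finite_subset by blast
    then have "card z = card (z - y) + card y"
      using z fin by (metis (no_types, lifting) card_Diff_subset card_mono le_add_diff_inverse2 mem_Collect_eq)
    then show "(- 1) ^ card (z - y) = (- 1) ^ card z * (- 1 :: int) ^ card y"
      by (simp add: power_add flip: power_mult_distrib)
  qed (use assms in auto)
  also have "\<dots> = of_bool (x - y = {})" using assms by (intro sum_Pow_alternating) simp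
  also have "(x - y = {}) = (x = y)" using assms by auto
  finally show ?thesis .
qed

definition simplex_sign :: "'a set \<Rightarrow> int" where
  "simplex_sign z = (- 1) ^ (card z - 1)"

text \<open>The zeta function of the face poset with its columns multiplied by the signs. The signs make
  the matrix an involution: the Moebius function of this poset is
  \<open>(-1)^(dim x - dim z)\<close>.\<close>

definition face_sign :: "'a set \<Rightarrow> 'a set \<Rightarrow> int" where
  "face_sign x z = of_bool (z \<subseteq> x) * simplex_sign z"

lemma simplex_sign_square [simp]: "simplex_sign z * simplex_sign z = 1"
  by (simp add: simplex_sign_def)

lemma simplicial_complexD:
  assumes "simplicial_complex K" "x \<in> K"
  shows "finite K" "finite x" "x \<noteq> {}" "z \<noteq> {} \<Longrightarrow> z \<subseteq> x \<Longrightarrow> z \<in> K"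
  using assms unfolding simplicial_complex_def by blast+

text \<open>A product of three equal signs is one sign, so the sum is the Euler characteristic of the full
  simplex on \<open>x \<inter> y\<close>; its faces lie in \<open>K\<close> as \<open>K\<close> is closed under subsets.\<close>

lemma face_sign_intersection:
  assumes K: "simplicial_complex K" and x: "x \<in> K"
  shows "(\<Sum>z\<in>K. face_sign x z * simplex_sign z * face_sign y z) = of_bool (x \<inter> y \<noteq> {})"
proof -
  have fin: "finite (x \<inter> y)" "finite K" using simplicial_complexD[OF K x] by simp_all
  have *: "{z. z \<noteq> {} \<and> z \<subseteq> x \<inter> y} = {z\<in>K. z \<subseteq> x \<inter> y}"
    using simplicial_complexD(4)[OF K x] simplicial_complexD(3)[OF K] by blast
  have "(\<Sum>z\<in>K. face_sign x z * simplex_sign z * face_sign y z) =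
      (\<Sum>z\<in>K. if z \<subseteq> x \<inter> y then simplex_sign z else 0)"
    by (rule sum.cong) (auto simp: face_sign_def)
  also have "\<dots> = (\<Sum>z | z \<noteq> {} \<and> z \<subseteq> x \<inter> y. simplex_sign z)"
    unfolding * using fin by (simp add: sum.inter_filter)
  also have "\<dots> = of_bool (x \<inter> y \<noteq> {})"
    unfolding simplex_sign_def by (rule sum_nonempty_subsets[OF fin(1)])
  finally show ?thesis .
qed

text \<open>The nonzero terms belong to the \<open>z\<close> between \<open>y\<close> and \<open>x\<close>. All such sets are simplices of \<open>K\<close>:
  they are subsets of \<open>x\<close> and contain the nonempty \<open>y\<close>.\<close>

lemma face_sign_involution:
  assumes K: "simplicial_complex K" and x: "x \<in> K" and y: "y \<in> K"
  shows "(\<Sum>z\<in>K. face_sign x z * face_sign z y) = of_bool (x = y)"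
proof (cases "y \<subseteq> x")
  case True
  have fin: "finite x" "finite K" "y \<noteq> {}"
    using simplicial_complexD[OF K x] simplicial_complexD[OF K y] by simp_all
  have *: "{z. y \<subseteq> z \<and> z \<subseteq> x} = {z\<in>K. y \<subseteq> z \<and> z \<subseteq> x}"
    using simplicial_complexD(4)[OF K x] fin(3) by blast
  have sign: "simplex_sign z = - ((- 1) ^ card z)" if "z \<in> K" for z
  proof -
    have "card z \<noteq> 0" using simplicial_complexD[OF K that] by simp
    then show ?thesis by (cases "card z") (auto simp: simplex_sign_def)
  qed
  have "(\<Sum>z\<in>K. face_sign x z * face_sign z y) =
      (\<Sum>z\<in>K. if y \<subseteq> z \<and> z \<subseteq> x then (- 1) ^ card z * (- 1) ^ card y else 0)"
    using sign y by (intro sum.cong) (auto simp: face_sign_def)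
  also have "\<dots> = (\<Sum>z | y \<subseteq> z \<and> z \<subseteq> x. (- 1) ^ card z * (- 1) ^ card y)"
    unfolding * using fin by (simp add: sum.inter_filter)
  also have "\<dots> = of_bool (x = y)" by (rule sum_subset_interval[OF fin(1) True])
  finally show ?thesis .
next
  case False
  then have "(\<Sum>z\<in>K. face_sign x z * face_sign z y) = 0"
    by (intro sum.neutral) (auto simp: face_sign_def)
  moreover have "x \<noteq> y" using False by blast
  ultimately show ?thesis by simp
qed

section \<open>Product complexes\<close>

text \<open>Distributivity. It reduces an identity between kernels on a product complex to identities
  between kernels on the factors.\<close>

lemma sum_listset_prod:
  fixes f :: "nat \<Rightarrow> 'a \<Rightarrow> 'r :: comm_semiring_1"
  shows "(\<Sum>xs\<in>listset As. \<Prod>i<length As. f i (xs ! i)) = (\<Prod>i<length As. \<Sum>x\<in>As ! i. f i x)"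
proof (induction As arbitrary: f)
  case (Cons A As)
  have listset_Cons: "listset (A # As) = (\<lambda>(a, p). a # p) ` (A \<times> listset As)"
    by (auto simp: set_Cons_def)
  have "(\<Sum>xs\<in>listset (A # As). \<Prod>i<length (A # As). f i (xs ! i)) =
      (\<Sum>(a, p)\<in>A \<times> listset As. f 0 a * (\<Prod>i<length As. f (Suc i) (p ! i)))"
    unfolding listset_Cons
    by (subst sum.reindex) (auto simp: inj_on_def prod.lessThan_Suc_shift case_prod_beta simp del: prod.lessThan_Suc)
  also have "\<dots> = (\<Sum>a\<in>A. f 0 a) * (\<Sum>p\<in>listset As. \<Prod>i<length As. f (Suc i) (p ! i))"
    by (simp add: sum_product sum.cartesian_product)
  also have "\<dots> = (\<Prod>i<length (A # As). \<Sum>x\<in>(A # As) ! i. f i x)"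
    by (simp add: Cons.IH[of "\<lambda>i. f (Suc i)"] prod.lessThan_Suc_shift del: prod.lessThan_Suc)
  finally show ?case .
qed simp

lemma sum_pcells:
  assumes "product_complex P"
  shows "(\<Sum>z\<in>pcells P. f z) = (\<Sum>zs\<in>listset P. f (listset zs))"
  unfolding pcells_def using inj_on_listset[OF assms] by (simp add: sum.reindex)

text \<open>All factors of a cell are nonempty, so they are its projections and inclusion can be
  tested on them.\<close>

lemma listset_subset_iff:
  assumes P: "product_complex P" and xs: "xs \<in> listset P" and zs: "zs \<in> listset P"
  shows "listset zs \<subseteq> listset xs \<longleftrightarrow> (\<forall>i<length P. zs ! i \<subseteq> xs ! i)"
proof
  have len: "length xs = length P" "length zs = length P" using xs zs by (auto simp: listset_conv)
  assume sub: "listset zs \<subseteq> listset xs"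
  show "\<forall>i<length P. zs ! i \<subseteq> xs ! i"
  proof (intro allI impI)
    fix i assume "i < length P"
    then show "zs ! i \<subseteq> xs ! i"
      using proj_listset[OF simplices_nonempty[OF P xs], of i]
        proj_listset[OF simplices_nonempty[OF P zs], of i] image_mono[OF sub] len by metis
  qed
next
  assume "\<forall>i<length P. zs ! i \<subseteq> xs ! i"
  then show "listset zs \<subseteq> listset xs" using xs zs by (auto simp: listset_conv subset_eq)
qed

lemma listset_Int_nonempty_iff:
  assumes "length xs = n" "length ys = n"
  shows "listset xs \<inter> listset ys \<noteq> {} \<longleftrightarrow> (\<forall>i<n. xs ! i \<inter> ys ! i \<noteq> {})"
proof
  assume "listset xs \<inter> listset ys \<noteq> {}"
  then show "\<forall>i<n. xs ! i \<inter> ys ! i \<noteq> {}" using assms by (auto simp: listset_conv)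
next
  assume "\<forall>i<n. xs ! i \<inter> ys ! i \<noteq> {}"
  then have "\<forall>i<n. \<exists>a. a \<in> xs ! i \<inter> ys ! i" by blast
  then obtain a where "\<forall>i<n. a i \<in> xs ! i \<inter> ys ! i" by metis
  then have "map a [0..<n] \<in> listset xs \<inter> listset ys" using assms by (simp add: listset_conv)
  then show "listset xs \<inter> listset ys \<noteq> {}" by blast
qed

lemma prod_of_bool: "(\<Prod>i<n. of_bool (p i)) = (of_bool (\<forall>i<n. p i) :: int)" for n :: nat
  by (induction n) (auto simp: less_Suc_eq)

definition cell_face_sign :: "'a product \<Rightarrow> 'a list set \<Rightarrow> 'a list set \<Rightarrow> int" where
  "cell_face_sign P x z = of_bool (z \<subseteq> x) * omega P z"

lemma omega_square [simp]: "omega P z * omega P z = 1"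
  by (simp add: omega_def)

lemma omega_listset:
  assumes "product_complex P" "zs \<in> listset P"
  shows "omega P (listset zs) = (\<Prod>i<length P. simplex_sign (zs ! i))"
  using assms by (simp add: omega_def cell_dim_listset simplex_sign_def power_sum)

text \<open>The kernel of a product complex is the tensor product of those of its factors.\<close>

lemma cell_face_sign_listset:
  assumes "product_complex P" "xs \<in> listset P" "zs \<in> listset P"
  shows "cell_face_sign P (listset xs) (listset zs) = (\<Prod>i<length P. face_sign (xs ! i) (zs ! i))"
  using assms
  by (simp add: cell_face_sign_def face_sign_def listset_subset_iff omega_listset prod.distrib prod_of_bool)

lemma factor_in_complex:
  assumes "product_complex P" "xs \<in> listset P" "i < length P"
  shows "simplicial_complex (P ! i)" "xs ! i \<in> P ! i"
  using assms by (auto simp: product_complex_def listset_conv)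

lemma cell_face_sign_intersection:
  assumes P: "product_complex P" and "x \<in> pcells P" "y \<in> pcells P"
  shows "(\<Sum>z\<in>pcells P. cell_face_sign P x z * omega P z * cell_face_sign P y z) = product_laplacian x y"
proof -
  obtain xs ys where xs: "xs \<in> listset P" "x = listset xs" and ys: "ys \<in> listset P" "y = listset ys"
    using assms by (auto simp: pcells_def)
  then have len: "length xs = length P" "length ys = length P" by (auto simp: listset_conv)
  have "(\<Sum>z\<in>pcells P. cell_face_sign P x z * omega P z * cell_face_sign P y z) =
      (\<Sum>zs\<in>listset P. \<Prod>i<length P.
        face_sign (xs ! i) (zs ! i) * simplex_sign (zs ! i) * face_sign (ys ! i) (zs ! i))"
    using P xs ys by (simp add: sum_pcells cell_face_sign_listset omega_listset prod.distrib)
  also have "\<dots> = (\<Prod>i<length P. of_bool (xs ! i \<inter> ys ! i \<noteq> {}))"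
    unfolding sum_listset_prod[where f = "\<lambda>i z. face_sign (xs ! i) z * simplex_sign z * face_sign (ys ! i) z"]
    using P xs ys by (intro prod.cong refl face_sign_intersection factor_in_complex) auto
  also have "\<dots> = product_laplacian x y"
    unfolding prod_of_bool product_laplacian_def xs ys using listset_Int_nonempty_iff[OF len] by simp
  finally show ?thesis .
qed

lemma cell_face_sign_involution:
  assumes P: "product_complex P" and "x \<in> pcells P" "y \<in> pcells P"
  shows "(\<Sum>z\<in>pcells P. cell_face_sign P x z * cell_face_sign P z y) = of_bool (x = y)"
proof -
  obtain xs ys where xs: "xs \<in> listset P" "x = listset xs" and ys: "ys \<in> listset P" "y = listset ys"
    using assms by (auto simp: pcells_def)
  then have len: "length xs = length P" "length ys = length P" by (auto simp: listset_conv)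
  have "(\<Sum>z\<in>pcells P. cell_face_sign P x z * cell_face_sign P z y) =
      (\<Sum>zs\<in>listset P. \<Prod>i<length P. face_sign (xs ! i) (zs ! i) * face_sign (zs ! i) (ys ! i))"
    using P xs ys by (simp add: sum_pcells cell_face_sign_listset prod.distrib)
  also have "\<dots> = (\<Prod>i<length P. of_bool (xs ! i = ys ! i))"
    unfolding sum_listset_prod[where f = "\<lambda>i z. face_sign (xs ! i) z * face_sign z (ys ! i)"]
    using P xs ys by (intro prod.cong refl face_sign_involution factor_in_complex) auto
  also have "\<dots> = of_bool (xs = ys)"
    unfolding prod_of_bool using len by (auto simp: list_eq_iff_nth_eq)
  also have "(xs = ys) = (x = y)"
    using inj_on_listset[OF P] xs ys by (auto dest: inj_onD)
  finally show ?thesis .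
qed

text \<open>This is the diagonal case of \<open>cell_face_sign_intersection\<close>: a cell meets itself, and two of
  the three signs cancel.\<close>

lemma cell_face_sign_row_sum:
  assumes P: "product_complex P" and x: "x \<in> pcells P"
  shows "(\<Sum>z\<in>pcells P. cell_face_sign P x z) = 1"
proof -
  obtain xs where xs: "xs \<in> listset P" "x = listset xs" using x by (auto simp: pcells_def)
  have "x \<inter> x \<noteq> {}"
    using listset_Int_nonempty_iff[of xs "length P" xs] simplices_nonempty[OF P xs(1)] xs
    by (auto simp: listset_conv)
  then have "1 = product_laplacian x x" by (simp add: product_laplacian_def)
  also have "\<dots> = (\<Sum>z\<in>pcells P. cell_face_sign P x z * omega P z * cell_face_sign P x z)"
    by (rule cell_face_sign_intersection[OF P x x, symmetric])
  also have "\<dots> = (\<Sum>z\<in>pcells P. cell_face_sign P x z)"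
    by (rule sum.cong) (auto simp: cell_face_sign_def)
  finally show ?thesis by simp
qed

section \<open>Signed complexes\<close>

definition signed_face_sign :: "'a signed \<Rightarrow> nat \<times> 'a list set \<Rightarrow> nat \<times> 'a list set \<Rightarrow> int" where
  "signed_face_sign G = (\<lambda>(i, x) (j, z). of_bool (i = j) * cell_face_sign (snd (G ! i)) x z)"

definition signed_omega :: "'a signed \<Rightarrow> nat \<times> 'a list set \<Rightarrow> int" where
  "signed_omega G = (\<lambda>(i, x). fst (G ! i) * omega (snd (G ! i)) x)"

lemma signed_complex_nth:
  assumes "signed_complex G" "i < length G"
  shows "fst (G ! i) \<in> {1, - 1}" "product_complex (snd (G ! i))"
  using assms nth_mem[of i G] by (auto simp: signed_complex_def case_prod_beta)

lemma sum_cells: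
  assumes "signed_complex G"
  shows "(\<Sum>c\<in>cells G. f c) = (\<Sum>i<length G. \<Sum>z\<in>pcells (snd (G ! i)). f (i, z))"
proof -
  have "finite (pcells (snd (G ! i)))" if "i < length G" for i
  proof -
    have "pcells (snd (G ! i)) \<subseteq> snd ` cells G" using that by (force simp: cells_def)
    then show ?thesis using finite_cells[OF assms] finite_surj by blast
  qed
  then show ?thesis unfolding cells_def by (subst sum.Sigma) auto
qed

text \<open>For kernels that vanish between different summands, a sum over all cells is a sum over the
  cells of one summand.\<close>

lemma sum_cells_block:
  fixes f :: "nat \<times> 'a list set \<Rightarrow> 'r :: comm_monoid_add"
  assumes G: "signed_complex G" and "i < length G" and "\<And>j z. j \<noteq> i \<Longrightarrow> f (j, z) = 0"
  shows "(\<Sum>c\<in>cells G. f c) = (\<Sum>z\<in>pcells (snd (G ! i)). f (i, z))"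
  unfolding sum_cells[OF G] using assms by (subst sum.remove[of _ i]) auto

lemma euler_char_eq_sum_signed_omega:
  assumes "signed_complex G"
  shows "euler_char G = (\<Sum>c\<in>cells G. signed_omega G c)"
  unfolding euler_char_def sum_cells[OF assms] sum_list_sum_nth
  by (simp add: atLeast0LessThan case_prod_beta product_euler_char_def signed_omega_def sum_distrib_left)

lemma signed_omega_square:
  assumes "signed_complex G" "c \<in> cells G"
  shows "signed_omega G c * signed_omega G c = 1"
proof (cases c)
  case (Pair i x)
  then have "fst (G ! i) \<in> {1, - 1}"
    using assms by (intro signed_complex_nth) (auto simp: cells_def)
  then show ?thesis using Pair by (auto simp: signed_omega_def)
qed

lemma signed_face_sign_involution:
  assumes G: "signed_complex G" and "b \<in> cells G" "c \<in> cells G"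
  shows "(\<Sum>z\<in>cells G. signed_face_sign G b z * signed_face_sign G z c) = of_bool (b = c)"
proof -
  obtain i x j y where b: "b = (i, x)" "i < length G" "x \<in> pcells (snd (G ! i))"
    and c: "c = (j, y)" "j < length G" "y \<in> pcells (snd (G ! j))"
    using assms by (auto simp: cells_def)
  have "(\<Sum>z\<in>cells G. signed_face_sign G b z * signed_face_sign G z c) =
      (\<Sum>z\<in>pcells (snd (G ! i)). signed_face_sign G b (i, z) * signed_face_sign G (i, z) c)"
    by (rule sum_cells_block[OF G b(2)]) (simp add: b signed_face_sign_def)
  then show ?thesis
    using cell_face_sign_involution[OF signed_complex_nth(2)[OF G b(2)] b(3)] b c
    by (cases "i = j") (auto simp: signed_face_sign_def)
qed

lemma connection_laplacian_factorization:
  assumes G: "signed_complex G" and "b \<in> cells G" "c \<in> cells G"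
  shows "connection_laplacian G b c =
    (\<Sum>z\<in>cells G. signed_face_sign G b z * signed_omega G z * signed_face_sign G c z)"
proof -
  obtain i x j y where b: "b = (i, x)" "i < length G" "x \<in> pcells (snd (G ! i))"
    and c: "c = (j, y)" "j < length G" "y \<in> pcells (snd (G ! j))"
    using assms by (auto simp: cells_def)
  let ?P = "snd (G ! i)"
  have *: "(\<Sum>z\<in>cells G. signed_face_sign G b z * signed_omega G z * signed_face_sign G c z) =
      (\<Sum>z\<in>pcells ?P. signed_face_sign G b (i, z) * signed_omega G (i, z) * signed_face_sign G c (i, z))"
    by (rule sum_cells_block[OF G b(2)]) (simp add: b signed_face_sign_def)
  show ?thesis
  proof (cases "i = j")
    case True
    have "connection_laplacian G b c = fst (G ! i) *
        (\<Sum>z\<in>pcells ?P. cell_face_sign ?P x z * omega ?P z * cell_face_sign ?P y z)"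
      using cell_face_sign_intersection[OF signed_complex_nth(2)[OF G b(2)] b(3), of y] b c True
      by (simp add: connection_laplacian_def)
    then show ?thesis
      unfolding * using b c True
      by (simp add: signed_face_sign_def signed_omega_def sum_distrib_left mult_ac)
  next
    case False
    then show ?thesis unfolding * using b c by (simp add: signed_face_sign_def connection_laplacian_def)
  qed
qed

lemma signed_face_sign_row_sum:
  assumes G: "signed_complex G" and "c \<in> cells G"
  shows "(\<Sum>z\<in>cells G. signed_face_sign G c z) = 1"
proof -
  obtain i x where c: "c = (i, x)" "i < length G" "x \<in> pcells (snd (G ! i))"
    using assms by (auto simp: cells_def)
  have "(\<Sum>z\<in>cells G. signed_face_sign G c z) = (\<Sum>z\<in>pcells (snd (G ! i)). signed_face_sign G c (i, z))"
    by (rule sum_cells_block[OF G c(2)]) (simp add: c signed_face_sign_def)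
  then show ?thesis
    using cell_face_sign_row_sum[OF signed_complex_nth(2)[OF G c(2)] c(3)] c
    by (simp add: signed_face_sign_def)
qed

text \<open>Each class consists of signed complexes, because \<open>strong_equiv\<close> relates signed complexes only.\<close>

lemma strong_ring_representative:
  assumes "X \<in> carrier strong_ring" "G \<in> X"
  shows "signed_complex G"
  using assms in_quotient_imp_subset[OF equiv_strong_equiv] by (auto simp: strong_ring_def)

text \<open>The shape of \<open>g\<close> is not given: \<open>inverts_mat\<close> compares with identity matrices whose size is the
  number of rows of the left factor, so \<open>A * g\<close> determines the number of columns of \<open>g\<close>, and
  \<open>g * A\<close> its number of rows.\<close>

lemma inverts_mat_unique:
  assumes "A \<in> carrier_mat n n" "B \<in> carrier_mat n n" "B * A = 1\<^sub>m n"
    and "inverts_mat A g" "inverts_mat g A"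
  shows "g = B"
proof -
  have "dim_col g = n" "dim_row g = n"
    using arg_cong[OF assms(4)[unfolded inverts_mat_def], of dim_col]
      arg_cong[OF assms(5)[unfolded inverts_mat_def], of dim_col] assms(1) by simp_all
  then have g: "g \<in> carrier_mat n n" by auto
  then have "g = (B * A) * g" using assms(3) by simp
  also have "\<dots> = B * (A * g)" using assms(1,2) g by (simp add: assoc_mult_mat)
  also have "\<dots> = B" using assms(1,2,4) by (simp add: inverts_mat_def)
  finally show ?thesis .
qed

theorem corollary2:
  fixes G :: "'a signed" and X :: "'a signed set" and cs :: "(nat \<times> 'a list set) list"
  assumes "X \<in> carrier strong_ring" and "G \<in> X"
    and "distinct cs" and "set cs = cells G"
  shows "det (mat_of cs (connection_laplacian G)) \<in> {1, - 1} \<and>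
    (\<exists>!g. inverts_mat (mat_of cs (connection_laplacian G)) g \<and>
          inverts_mat g (mat_of cs (connection_laplacian G))) \<and>
    (\<forall>g. inverts_mat (mat_of cs (connection_laplacian G)) g \<and>
         inverts_mat g (mat_of cs (connection_laplacian G)) \<longrightarrow>
         (\<Sum>i<length cs. \<Sum>j<length cs. g $$ (i, j)) = euler_char G)"
proof -
  let ?L = "mat_of cs (connection_laplacian G)" and ?n = "length cs"
  have G: "signed_complex G" using assms(1,2) by (rule strong_ring_representative)
  define B where "B = mat_of cs (\<lambda>x y.
    \<Sum>z\<in>set cs. signed_face_sign G z x * signed_omega G z * signed_face_sign G z y)"
  have carrier: "?L \<in> carrier_mat ?n ?n" "B \<in> carrier_mat ?n ?n" by (simp_all add: B_def)
  have LB: "?L * B = 1\<^sub>m ?n" and BL: "B * ?L = 1\<^sub>m ?n"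
    unfolding B_def
    by (rule involution_factorization_inverse[OF assms(3)];
        simp add: assms(4) signed_face_sign_involution[OF G] signed_omega_square[OF G]
          connection_laplacian_factorization[OF G])+
  \<comment> \<open>Both determinants are integers, so each is a unit.\<close>
  have "det ?L * det B = 1"
    using det_mult[OF carrier] LB by simp
  then have "det ?L \<in> {1, - 1}" using pos_zmult_eq_1_iff_lemma zmult_eq_1_iff by blast
  moreover have inv: "inverts_mat ?L B" "inverts_mat B ?L"
    using LB BL carrier_matD(1)[OF carrier(1)] carrier_matD(1)[OF carrier(2)]
    by (simp_all add: inverts_mat_def)
  moreover have uniq: "g = B" if "inverts_mat ?L g \<and> inverts_mat g ?L" for g
    using inverts_mat_unique[OF carrier BL] that by blast
  moreover have "(\<Sum>i<?n. \<Sum>j<?n. B $$ (i, j)) = euler_char G"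
    unfolding B_def sum_entries_mat_of[OF assms(3)] euler_char_eq_sum_signed_omega[OF G] assms(4)
    by (rule involution_factorization_total) (rule signed_face_sign_row_sum[OF G])
  ultimately show ?thesis by blast
qed

end
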